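(* Let $r\ge 2$, let $\{\xi_i\}_{i=1}^{r+1}\subset[0,1]$ be pairwise distinct points with $\xi_1=0$ and $\xi_{r+1}=1$, and let $f_r^\xi:[-\pi,\pi]\to\mathbb{C}^{r\times r}$ be the associated symbol. Denote by $\lambda_1(f_r^\xi(\theta))\le\cdots\le\lambda_r(f_r^\xi(\theta))$ the eigenvalues of the Hermitian matrix $f_r^\xi(\theta)$. Then: 1. there exist constants $C_1,C_2>0$ (dependent on $f_r^\xi$) such that, for every $\theta\in[-\pi,\pi]$, $$C_1(2-2\cos\theta)\le\lambda_1(f_r^\xi(\theta))\le C_2(2-2\cos\theta);$$ 2. there exist constants $m,M>0$ (dependent on $f_r^\xi$) such that, for every $\theta\in[-\pi,\pi]$, $$0<m\le\lambda_j(f_r^\xi(\theta))\le M,\qquad j=2,\ldots,r.$$ In particular one can take $m=\lambda_1(S_\xi)>0$, the minimal eigenvalue of the south-east principal submatrix $S_\xi=[(f_r^\xi)_{i,j}]_{i,j=2}^r$ of size $(r-1)\times(r-1)$, whose entries do not depend on $\theta$.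
   Context: Let $\{\varphi_i\}_{i=1}^{r+1}$ be the basis of $\mathbb{P}_r$ (real univariate polynomials of degree at most $r$) determined by $\varphi_j(\xi_i)=\delta_{i,j}$. Let $A^{\mathrm{loc}}\in\mathbb{R}^{(r+1)\times(r+1)}$ be the local stiffness matrix $A^{\mathrm{loc}}_{i,j}=\int_0^1\varphi_i'(x)\varphi_j'(x)\,\mathrm{d}x$. Define $A_\xi\in\mathbb{R}^{(r+1)\times(r+1)}$ by $(A_\xi)_{i,j}=A^{\mathrm{loc}}_{1,1}+A^{\mathrm{loc}}_{r+1,r+1}$ if $(i,j)=(1,1)$ or $(i,j)=(r+1,r+1)$, and $(A_\xi)_{i,j}=A^{\mathrm{loc}}_{i,j}$ otherwise. Let $\alpha_\xi\in\mathbb{R}^{r\times r}$ be the leading $r\times r$ block of $A_\xi$, let $\widetilde\beta_\xi\in\mathbb{R}^{1\times r}$ be the row formed by the first $r$ entries of the last row of $A_\xi$, and let $\beta_\xi\in\mathbb{R}^{r\times r}$ be the matrix whose first row is $\widetilde\beta_\xi$ and whose other rows are zero. The symbol is $$f_r^\xi(\theta)=\alpha_\xi+\beta_\xi e^{\mathrm{i}\theta}+\beta_\xi^T e^{-\mathrm{i}\theta},\qquad \theta\in[-\pi,\pi],$$ where $\mathrm{i}$ in the exponent is the imaginary unit. *)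

theory Defs
  imports
    "HOL-Analysis.Henstock_Kurzweil_Integration"
    "HOL-Computational_Algebra.Fundamental_Theorem_Algebra"
    "Jordan_Normal_Form.Schur_Decomposition"
begin

unbundle no vec_syntax

text \<open>
  Nodes \<open>\<xi> 1, \<dots>, \<xi> (r + 1)\<close> and basis polynomials are numbered from 1, whereas
  matrix entries are numbered from 0: the entry written \<open>(i, j)\<close> on paper is
  \<open>A $$ (i - 1, j - 1)\<close>.
\<close>

definition nodal_basis :: "nat \<Rightarrow> (nat \<Rightarrow> real) \<Rightarrow> nat \<Rightarrow> real poly" where
  "nodal_basis r \<xi> j =
    (THE p. degree p \<le> r \<and> (\<forall>i\<in>{1..r+1}. poly p (\<xi> i) = (if i = j then 1 else 0)))"

definition local_stiffness :: "nat \<Rightarrow> (nat \<Rightarrow> real) \<Rightarrow> real mat" where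
  "local_stiffness r \<xi> = mat (r+1) (r+1) (\<lambda>(i,j).
     integral {0..1} (\<lambda>x. poly (pderiv (nodal_basis r \<xi> (i+1))) x
                           * poly (pderiv (nodal_basis r \<xi> (j+1))) x))"

definition assembled_stiffness :: "nat \<Rightarrow> (nat \<Rightarrow> real) \<Rightarrow> real mat" where
  "assembled_stiffness r \<xi> = mat (r+1) (r+1) (\<lambda>(i,j).
     if (i,j) = (0,0) \<or> (i,j) = (r,r)
     then local_stiffness r \<xi> $$ (0,0) + local_stiffness r \<xi> $$ (r,r)
     else local_stiffness r \<xi> $$ (i,j))"

definition alpha_block :: "nat \<Rightarrow> (nat \<Rightarrow> real) \<Rightarrow> real mat" where
  "alpha_block r \<xi> = mat r r (\<lambda>(i,j). assembled_stiffness r \<xi> $$ (i,j))"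

definition beta_row :: "nat \<Rightarrow> (nat \<Rightarrow> real) \<Rightarrow> real mat" where
  "beta_row r \<xi> = mat 1 r (\<lambda>(i,j). assembled_stiffness r \<xi> $$ (r,j))"

definition beta_block :: "nat \<Rightarrow> (nat \<Rightarrow> real) \<Rightarrow> real mat" where
  "beta_block r \<xi> = mat r r (\<lambda>(i,j). if i = 0 then beta_row r \<xi> $$ (0,j) else 0)"

definition symbol :: "nat \<Rightarrow> (nat \<Rightarrow> real) \<Rightarrow> real \<Rightarrow> complex mat" where
  "symbol r \<xi> \<theta> =
     map_mat complex_of_real (alpha_block r \<xi>)
     + exp (\<i> * complex_of_real \<theta>) \<cdot>\<^sub>m map_mat complex_of_real (beta_block r \<xi>)
     + exp (- (\<i> * complex_of_real \<theta>)) \<cdot>\<^sub>m map_mat complex_of_real (transpose_mat (beta_block r \<xi>))"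

definition south_east :: "'a mat \<Rightarrow> 'a mat" where
  "south_east A = mat (dim_row A - 1) (dim_col A - 1) (\<lambda>(i,j). A $$ (i+1, j+1))"

definition hermitian :: "complex mat \<Rightarrow> bool" where
  "hermitian A \<longleftrightarrow> square_mat A \<and> mat_adjoint A = A"

text \<open>
  The eigenvalues, repeated according to algebraic multiplicity and sorted increasingly.
  Only meaningful for Hermitian matrices, where taking real parts changes nothing; see
  \<open>sorted_eigenvalues_hermitian\<close> below.
\<close>
definition sorted_eigenvalues :: "complex mat \<Rightarrow> real list" where
  "sorted_eigenvalues A = sorted_list_of_multiset (image_mset Re (proots (char_poly A)))"

definition eig :: "nat \<Rightarrow> complex mat \<Rightarrow> real" where
  "eig j A = sorted_eigenvalues A ! (j - 1)"

lemma nodal_basis_ex1: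
  assumes inj: "inj_on \<xi> {1..r+1}" and j: "j \<in> {1..r+1}"
  shows "\<exists>!p :: real poly. degree p \<le> r \<and>
           (\<forall>i\<in>{1..r+1}. poly p (\<xi> i) = (if i = j then 1 else 0))"
proof (rule ex_ex1I)
  define q where "q = (\<Prod>k\<in>{1..r+1}-{j}. [:- \<xi> k, 1:])"
  define c where "c = (\<Prod>k\<in>{1..r+1}-{j}. \<xi> j - \<xi> k)"
  have ne: "\<xi> j \<noteq> \<xi> k" if "k \<in> {1..r+1}-{j}" for k
    using inj j that by (metis DiffE inj_onD insertI1)
  have c0: "c \<noteq> 0" unfolding c_def using ne by (subst prod_zero_iff) auto
  have q_eval: "poly q x = (\<Prod>k\<in>{1..r+1}-{j}. x - \<xi> k)" for x
    unfolding q_def by (simp add: poly_prod)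
  have "degree q \<le> card ({1..r+1}-{j})"
  proof -
    have "degree q \<le> (\<Sum>k\<in>{1..r+1}-{j}. degree [:- \<xi> k, 1:])"
      unfolding q_def by (rule order.trans[OF degree_prod_sum_le]) (auto simp: o_def)
    then show ?thesis by simp
  qed
  also have "\<dots> = r" using j by simp
  finally have "degree (smult (1 / c) q) \<le> r" using c0 by simp
  moreover have "poly (smult (1 / c) q) (\<xi> i) = (if i = j then 1 else 0)"
    if i: "i \<in> {1..r+1}" for i
  proof (cases "i = j")
    case True
    then show ?thesis using c0 by (simp add: q_eval c_def)
  next
    case False
    have "poly q (\<xi> i) = 0"
      unfolding q_eval by (rule prod_zero) (use i False in auto)
    then show ?thesis using False by simp
  qed
  ultimately show "\<exists>p. degree p \<le> r \<and> (\<forall>i\<in>{1..r+1}. poly p (\<xi> i) = (if i = j then 1 else 0))"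
    by blast
next
  fix p q :: "real poly"
  assume p: "degree p \<le> r \<and> (\<forall>i\<in>{1..r+1}. poly p (\<xi> i) = (if i = j then 1 else 0))"
    and q: "degree q \<le> r \<and> (\<forall>i\<in>{1..r+1}. poly q (\<xi> i) = (if i = j then 1 else 0))"
  have "card (\<xi> ` {1..r+1}) = r + 1" using card_image[OF inj] by simp
  with p q show "p = q" by (intro poly_eqI_degree[of "\<xi> ` {1..r+1}"]) auto
qed

lemma hermitian_iff:
  assumes A: "A \<in> carrier_mat n n"
  shows "hermitian A \<longleftrightarrow> (\<forall>i<n. \<forall>j<n. A $$ (i,j) = cnj (A $$ (j,i)))"
proof -
  have dims: "dim_row (mat_adjoint A) = n" "dim_col (mat_adjoint A) = n"
    using A by (auto simp: mat_adjoint_def)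
  have idx: "mat_adjoint A $$ (i,j) = cnj (A $$ (j,i))" if "i < n" "j < n" for i j
    using A that by (auto simp: mat_adjoint_def mat_of_rows_def)
  have "mat_adjoint A = A \<longleftrightarrow> (\<forall>i<n. \<forall>j<n. mat_adjoint A $$ (i,j) = A $$ (i,j))"
    using A dims by (simp add: mat_eq_iff)
  also have "\<dots> \<longleftrightarrow> (\<forall>i<n. \<forall>j<n. A $$ (i,j) = cnj (A $$ (j,i)))"
    using idx by metis
  finally show ?thesis
    using A by (simp add: hermitian_def)
qed

lemma hermitian_eigenvalue_real:
  assumes A: "A \<in> carrier_mat n n" and H: "hermitian A" and ev: "eigenvalue A z"
  shows "complex_of_real (Re z) = z"
proof -
  obtain v where v: "v \<in> carrier_vec n" "v \<noteq> 0\<^sub>v n" "A *\<^sub>v v = z \<cdot>\<^sub>v v"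
    using ev A unfolding eigenvalue_def eigenvector_def by auto
  define s where "s = (\<Sum>i<n. v $ i * cnj (v $ i))"
  define Q where "Q = (\<Sum>i<n. \<Sum>j<n. A $$ (i,j) * v $ j * cnj (v $ i))"
  have sym: "cnj (A $$ (i,j)) = A $$ (j,i)" if "i < n" "j < n" for i j
    using H[unfolded hermitian_iff[OF A]] that by (metis complex_cnj_cnj)
  have row: "(\<Sum>j<n. A $$ (i,j) * v $ j) = z * v $ i" if "i < n" for i
  proof -
    have "(A *\<^sub>v v) $ i = (\<Sum>j<n. A $$ (i,j) * v $ j)"
      using A v(1) that by (auto simp: scalar_prod_def lessThan_atLeast0)
    then show ?thesis using v that by simp
  qed
  have "Q = (\<Sum>i<n. z * v $ i * cnj (v $ i))"
    unfolding Q_def by (intro sum.cong) (auto simp: row sum_distrib_right[symmetric])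
  then have Qz: "Q = z * s" by (simp add: s_def sum_distrib_left mult.assoc)
  have "cnj Q = (\<Sum>i<n. \<Sum>j<n. A $$ (j,i) * cnj (v $ j) * v $ i)"
    unfolding Q_def by (auto simp: sym intro!: sum.cong)
  also have "\<dots> = Q"
    unfolding Q_def by (subst sum.swap) (auto intro!: sum.cong)
  finally have "cnj Q = Q" .
  moreover have "cnj s = s" by (simp add: s_def mult.commute)
  moreover have "s \<noteq> 0"
  proof
    assume "s = 0"
    moreover have "s = complex_of_real (\<Sum>i<n. (cmod (v $ i))\<^sup>2)"
      by (simp add: s_def complex_mult_cnj cmod_power2)
    ultimately have "(\<Sum>i<n. (cmod (v $ i))\<^sup>2) = 0" by (metis of_real_eq_0_iff)
    then have "\<forall>i<n. v $ i = 0" by (simp add: sum_nonneg_eq_0_iff)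
    with v show False by (metis eq_vecI carrier_vecD index_zero_vec(1) index_zero_vec(2))
  qed
  ultimately have "cnj z = z" using Qz by (metis complex_cnj_mult mult_right_cancel)
  then show ?thesis by (simp add: complex_eq_iff)
qed

lemma sorted_eigenvalues_hermitian:
  assumes A: "A \<in> carrier_mat n n" and H: "hermitian A"
  shows "sorted (sorted_eigenvalues A)"
    and "length (sorted_eigenvalues A) = n"
    and "char_poly A = (\<Prod>x\<leftarrow>sorted_eigenvalues A. [:- complex_of_real x, 1:])"
proof -
  have deg: "degree (char_poly A) = n" "lead_coeff (char_poly A) = 1"
    using degree_monic_char_poly[OF A] by auto
  then have nz: "char_poly A \<noteq> 0" by auto
  show "sorted (sorted_eigenvalues A)" by (simp add: sorted_eigenvalues_def)
  have mset: "mset (sorted_eigenvalues A) = image_mset Re (proots (char_poly A))"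
    by (simp add: sorted_eigenvalues_def)
  have "size (mset (sorted_eigenvalues A)) = n"
    unfolding mset using deg by (simp add: size_proots_complex)
  then show "length (sorted_eigenvalues A) = n" by simp
  have real: "complex_of_real (Re z) = z" if "z \<in># proots (char_poly A)" for z
  proof (rule hermitian_eigenvalue_real[OF A H])
    show "eigenvalue A z" using that nz by (simp add: eigenvalue_root_char_poly[OF A])
  qed
  have "(\<Prod>x\<leftarrow>sorted_eigenvalues A. [:- complex_of_real x, 1:])
      = (\<Prod>x\<in>#mset (sorted_eigenvalues A). [:- complex_of_real x, 1:])"
    by (simp only: mset_map[symmetric] prod_mset_prod_list)
  also have "\<dots> = (\<Prod>z\<in>#proots (char_poly A). [:- z, 1:])"
    unfolding mset multiset.map_comp o_def using real
    by (intro arg_cong[of _ _ prod_mset] image_mset_cong) simp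
  also have "\<dots> = char_poly A"
    using complex_poly_decompose_multiset[of "char_poly A"] deg by simp
  finally show "char_poly A = (\<Prod>x\<leftarrow>sorted_eigenvalues A. [:- complex_of_real x, 1:])" ..
qed

lemma symbol_carrier: "symbol r \<xi> \<theta> \<in> carrier_mat r r"
  by (auto simp: symbol_def alpha_block_def beta_block_def)

lemma symbol_hermitian: "hermitian (symbol r \<xi> \<theta>)"
proof -
  have sym: "local_stiffness r \<xi> $$ (i,j) = local_stiffness r \<xi> $$ (j,i)"
    if "i \<le> r" "j \<le> r" for i j
    using that by (simp add: local_stiffness_def mult.commute)
  have e: "exp (\<i> * complex_of_real \<theta>) = cis \<theta>"
    "exp (- (\<i> * complex_of_real \<theta>)) = cis (- \<theta>)"
    unfolding cis_conv_exp by (simp_all only: of_real_minus mult_minus_right)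
  show ?thesis
    unfolding hermitian_iff[OF symbol_carrier]
  proof (intro allI impI)
    fix i j assume ij: "i < r" "j < r"
    then have "assembled_stiffness r \<xi> $$ (i,j) = assembled_stiffness r \<xi> $$ (j,i)"
      using sym[of i j] by (auto simp: assembled_stiffness_def)
    with ij show "symbol r \<xi> \<theta> $$ (i,j) = cnj (symbol r \<xi> \<theta> $$ (j,i))"
      by (simp add: symbol_def alpha_block_def beta_block_def beta_row_def e cis_cnj)
  qed
qed

lemma south_east_hermitian:
  assumes A: "A \<in> carrier_mat n n" and H: "hermitian A"
  shows "south_east A \<in> carrier_mat (n - 1) (n - 1)" and "hermitian (south_east A)"
proof -
  show C: "south_east A \<in> carrier_mat (n - 1) (n - 1)"
    using A by (auto simp: south_east_def)
  show "hermitian (south_east A)"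
    unfolding hermitian_iff[OF C]
  proof (intro allI impI)
    fix i j assume ij: "i < n - 1" "j < n - 1"
    then have "A $$ (i+1, j+1) = cnj (A $$ (j+1, i+1))"
      using H[unfolded hermitian_iff[OF A], rule_format, of "i+1" "j+1"] by auto
    then show "south_east A $$ (i,j) = cnj (south_east A $$ (j,i))"
      using A ij unfolding south_east_def by simp
  qed
qed

end

theory Submission
  imports Defs
begin

text \<open>
  The symbol is an energy in disguise. Given \<open>u \<in> \<complex>\<^sup>r\<close>, let \<open>U \<in> \<complex>\<^sup>r\<^sup>+\<^sup>1\<close> extend it by the
  quasi-periodic value \<open>U\<^sub>r = e\<^sup>-\<^sup>i\<^sup>\<theta> u\<^sub>0\<close>, and let \<open>p\<close> be the polynomial of degree at most \<open>r\<close> with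
  nodal values \<open>U\<close>. Then \<open>u\<^sup>* f(\<theta>) u = \<integral>\<^sub>0\<^sup>1 \<bar>p'\<bar>\<^sup>2\<close> (\<open>quad_form_symbol\<close> together with
  \<open>stiffness_form_eq_energy\<close>, applied to real and imaginary parts). Everything follows from this
  identity and the elementary bound \<open>\<bar>p(x) - p(0)\<bar>\<^sup>2 \<le> \<integral>\<^sub>0\<^sup>1 \<bar>p'\<bar>\<^sup>2\<close> on \<open>[0, 1]\<close>
  (\<open>poly_oscillation_le_energy\<close>).

  Lower bound for the smallest eigenvalue: at \<open>x = 1\<close> the oscillation bound controls
  \<open>\<bar>e\<^sup>-\<^sup>i\<^sup>\<theta> - 1\<bar>\<^sup>2 \<bar>u\<^sub>0\<bar>\<^sup>2 = (2 - 2 cos \<theta>) \<bar>u\<^sub>0\<bar>\<^sup>2\<close>, and at the other nodes it controls the distance of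
  the remaining components from \<open>u\<^sub>0\<close>. Upper bound: for \<open>u = (1, \<dots>, 1)\<close> the polynomial is
  \<open>1 + (e\<^sup>-\<^sup>i\<^sup>\<theta> - 1) \<phi>\<^sub>r\<^sub>+\<^sub>1\<close>, whose energy is a multiple of \<open>2 - 2 cos \<theta>\<close>, so the
  Rayleigh quotient of this vector suffices.

  The remaining eigenvalues: only the first row and column of the symbol depend on \<open>\<theta>\<close>, and Cauchy
  interlacing gives \<open>\<lambda>\<^sub>2(f(\<theta>)) \<ge> \<lambda>\<^sub>1(S)\<close> for the south-east block \<open>S\<close>. Vectors for \<open>S\<close> correspond to
  \<open>u\<^sub>0 = 0\<close>, for which the oscillation bound controls every component, so \<open>\<lambda>\<^sub>1(S) > 0\<close>. The upper bound
  is the boundedness of the energy form.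

  The Rayleigh bound and interlacing need an orthonormal eigenbasis of a Hermitian matrix in which
  the eigenvalues occur in increasing order (\<open>hermitian_spectral\<close>); it is obtained by
  Gram-Schmidt from a Schur triangularisation with prescribed diagonal.
\<close>

section \<open>Hermitian forms\<close>

text \<open>
  Vectors of length \<open>n\<close> are functions on \<open>nat\<close> of which only the values below \<open>n\<close> matter; this lets
  a vector be shifted, extended and combined linearly without tracking dimensions.
\<close>

definition mat_app :: "nat \<Rightarrow> complex mat \<Rightarrow> (nat \<Rightarrow> complex) \<Rightarrow> nat \<Rightarrow> complex" where
  "mat_app n A x i = (\<Sum>j<n. A $$ (i,j) * x j)"

definition cinner :: "nat \<Rightarrow> (nat \<Rightarrow> complex) \<Rightarrow> (nat \<Rightarrow> complex) \<Rightarrow> complex" where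
  "cinner n x y = (\<Sum>i<n. x i * cnj (y i))"

definition sqnorm :: "nat \<Rightarrow> (nat \<Rightarrow> complex) \<Rightarrow> real" where
  "sqnorm n x = (\<Sum>i<n. (cmod (x i))\<^sup>2)"

definition quad_form :: "complex mat \<Rightarrow> (nat \<Rightarrow> complex) \<Rightarrow> real" where
  "quad_form A x = Re (cinner (dim_row A) (mat_app (dim_row A) A x) x)"

lemma cinner_cong: "(\<And>i. i < n \<Longrightarrow> x i = x' i) \<Longrightarrow> (\<And>i. i < n \<Longrightarrow> y i = y' i) \<Longrightarrow> cinner n x y = cinner n x' y'"
  by (simp add: cinner_def)

lemma mat_app_cong: "(\<And>i. i < n \<Longrightarrow> x i = x' i) \<Longrightarrow> mat_app n A x i = mat_app n A x' i"
  by (simp add: mat_app_def)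

lemma cinner_diff: "cinner n (\<lambda>i. x i - y i) z = cinner n x z - cinner n y z"
  by (simp add: cinner_def algebra_simps sum_subtractf)

lemma cinner_scale: "cinner n (\<lambda>i. c * x i) z = c * cinner n x z"
  by (simp add: cinner_def algebra_simps sum_distrib_left)

lemma cinner_sum: "cinner n (\<lambda>i. \<Sum>k<m. c k * u k i) z = (\<Sum>k<m. c k * cinner n (u k) z)"
  unfolding cinner_def sum_distrib_right sum_distrib_left
  by (subst sum.swap) (simp add: mult.assoc)

lemma cinner_commute: "cinner n y x = cnj (cinner n x y)"
  by (simp add: cinner_def mult.commute)

lemma cinner_self: "cinner n x x = complex_of_real (sqnorm n x)"
  by (simp only: cinner_def sqnorm_def complex_norm_square of_real_sum)

lemma sqnorm_nonneg: "sqnorm n x \<ge> 0"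
  by (simp add: sqnorm_def sum_nonneg)

lemma sqnorm_eq_0: "sqnorm n x = 0 \<longleftrightarrow> (\<forall>i<n. x i = 0)"
  by (auto simp: sqnorm_def sum_nonneg_eq_0_iff)

lemma mat_app_diff: "mat_app n A (\<lambda>i. x i - y i) j = mat_app n A x j - mat_app n A y j"
  by (simp add: mat_app_def algebra_simps sum_subtractf)

lemma mat_app_scale: "mat_app n A (\<lambda>i. c * x i) j = c * mat_app n A x j"
  by (simp add: mat_app_def algebra_simps sum_distrib_left)

lemma mat_app_sum: "mat_app n A (\<lambda>i. \<Sum>k<m. c k * u k i) j = (\<Sum>k<m. c k * mat_app n A (u k) j)"
  unfolding mat_app_def sum_distrib_left
  by (subst sum.swap) (simp add: mult.left_commute)

lemma mat_app_mult:
  assumes "A \<in> carrier_mat n n" "B \<in> carrier_mat n n" "i < n"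
  shows "mat_app n (A * B) x i = mat_app n A (mat_app n B x) i"
proof -
  have e: "(A * B) $$ (i,j) = (\<Sum>k<n. A $$ (i,k) * B $$ (k,j))" if "j < n" for j
    using assms that by (simp add: scalar_prod_def lessThan_atLeast0)
  have "mat_app n (A * B) x i = (\<Sum>j<n. \<Sum>k<n. A $$ (i,k) * B $$ (k,j) * x j)"
    by (simp add: mat_app_def e sum_distrib_right)
  also have "\<dots> = mat_app n A (mat_app n B x) i"
    unfolding mat_app_def sum_distrib_left by (subst sum.swap) (simp add: mult.assoc)
  finally show ?thesis .
qed

lemma mat_app_one: "i < n \<Longrightarrow> mat_app n (1\<^sub>m n) x i = x i"
  by (simp add: mat_app_def if_distrib[of "\<lambda>c. c * _"] cong: if_cong)

lemma hermitian_cinner_swap: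
  assumes A: "A \<in> carrier_mat n n" and H: "hermitian A"
  shows "cinner n (mat_app n A x) y = cinner n x (mat_app n A y)"
proof -
  have s: "cnj (A $$ (i,j)) = A $$ (j,i)" if "i < n" "j < n" for i j
    using H[unfolded hermitian_iff[OF A]] that by (metis complex_cnj_cnj)
  have "cinner n (mat_app n A x) y = (\<Sum>i<n. \<Sum>j<n. A $$ (i,j) * x j * cnj (y i))"
    by (simp add: cinner_def mat_app_def sum_distrib_right)
  also have "\<dots> = (\<Sum>j<n. \<Sum>i<n. A $$ (i,j) * x j * cnj (y i))"
    by (rule sum.swap)
  also have "\<dots> = cinner n x (mat_app n A y)"
    by (simp add: cinner_def mat_app_def sum_distrib_left s mult_ac)
  finally show ?thesis .
qed

section \<open>Orthonormal eigenbases\<close>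

text \<open>
  The vectors \<open>x\<close> with \<open>(Q x)\<^sub>j = 0\<close> for all \<open>j \<ge> k\<close> are the span of the first \<open>k\<close> columns of \<open>P\<close>. Since
  \<open>Q A = B Q\<close> with \<open>B\<close> upper triangular, these spaces form an \<open>A\<close>-invariant flag on whose successive
  quotients \<open>A\<close> acts by the diagonal entries of \<open>B\<close>. The part \<open>v\<close> of the next column that is
  orthogonal to the preceding space therefore satisfies \<open>A v - e\<^sub>k v\<close> in that space; as \<open>A\<close> is
  Hermitian, this difference is also orthogonal to it, hence zero. The clause on \<open>Q (u i)\<close> is what
  keeps the induction inside the flag.
\<close>

lemma eigenvector_flag:
  assumes A: "A \<in> carrier_mat n n" and H: "hermitian A"
    and W: "similar_mat_wit A B P Q" and up: "upper_triangular B"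
    and es: "\<And>k. k < n \<Longrightarrow> B $$ (k,k) = complex_of_real (e k)"
    and "k \<le> n"
  shows "\<exists>u. (\<forall>i<k. \<forall>j<k. cinner n (u i) (u j) = (if i = j then 1 else 0))
      \<and> (\<forall>i<k. \<forall>m<n. mat_app n A (u i) m = complex_of_real (e i) * u i m)
      \<and> (\<forall>i<k. \<forall>j. i < j \<and> j < n \<longrightarrow> mat_app n Q (u i) j = 0)
      \<and> (\<forall>x. (\<forall>j. k \<le> j \<and> j < n \<longrightarrow> mat_app n Q x j = 0) \<longrightarrow>
            (\<exists>c. \<forall>m<n. x m = (\<Sum>i<k. c i * u i m)))"
  using \<open>k \<le> n\<close>
proof (induction k)
  note sw = similar_mat_witD2[OF A W]
  have PQ: "mat_app n P (mat_app n Q x) i = x i" if "i < n" for x i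
    using that sw mat_app_mult[of P n Q i x] mat_app_one by simp
  case 0
  have "x m = 0" if "\<forall>j<n. mat_app n Q x j = 0" "m < n" for x m
  proof -
    have "mat_app n P (mat_app n Q x) m = mat_app n P (\<lambda>_. 0) m"
      by (rule mat_app_cong) (use that in auto)
    then show ?thesis using PQ[OF that(2)] by (simp add: mat_app_def)
  qed
  then show ?case by auto
next
  note sw = similar_mat_witD2[OF A W]
  have QP: "mat_app n Q (mat_app n P x) i = x i" if "i < n" for x i
    using that sw mat_app_mult[of Q n P i x] mat_app_one by simp
  have QA: "mat_app n Q (mat_app n A x) j = mat_app n B (mat_app n Q x) j" if j: "j < n" for x j
  proof -
    have "Q * A = Q * (P * (B * Q))" using sw by simp
    also have "\<dots> = (Q * P) * (B * Q)"
      using sw(4-7) by (intro assoc_mult_mat[symmetric]) auto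
    also have "\<dots> = B * Q" using sw by simp
    finally have "Q * A = B * Q" .
    then show ?thesis using mat_app_mult[of Q n A j x] mat_app_mult[of B n Q j x] sw j by simp
  qed
  case (Suc k)
  then have k: "k < n" by simp
  then obtain u where on: "\<forall>i<k. \<forall>j<k. cinner n (u i) (u j) = (if i = j then 1 else 0)"
    and ev: "\<forall>i<k. \<forall>m<n. mat_app n A (u i) m = complex_of_real (e i) * u i m"
    and fl: "\<forall>i<k. \<forall>j. i < j \<and> j < n \<longrightarrow> mat_app n Q (u i) j = 0"
    and sp: "\<forall>x. (\<forall>j. k \<le> j \<and> j < n \<longrightarrow> mat_app n Q x j = 0) \<longrightarrow>
            (\<exists>c. \<forall>m<n. x m = (\<Sum>i<k. c i * u i m))"
    using Suc.IH[OF less_imp_le[OF k]] by blast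
  note on = on[rule_format] and ev = ev[rule_format] and fl = fl[rule_format, OF _ conjI]
    and sp = sp[rule_format]
  \<comment> \<open>\<open>p\<close> is the next column of \<open>P\<close>, and \<open>v\<close> is its component orthogonal to the vectors found so far.\<close>
  define p where "p = mat_app n P (\<lambda>j. if j = k then 1 else 0)"
  define v where "v = (\<lambda>m. p m - (\<Sum>i<k. cinner n p (u i) * u i m))"
  have Qp: "mat_app n Q p j = (if j = k then 1 else 0)" if "j < n" for j
    unfolding p_def by (rule QP[OF that])
  have vu: "cinner n v (u i) = 0" if "i < k" for i
  proof -
    have "cinner n v (u i) = cinner n p (u i) - (\<Sum>l<k. cinner n p (u l) * cinner n (u l) (u i))"
      by (simp only: v_def cinner_diff cinner_sum)
    also have "(\<Sum>l<k. cinner n p (u l) * cinner n (u l) (u i)) = (\<Sum>l<k. if l = i then cinner n p (u l) else 0)"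
      by (rule sum.cong) (use on that in auto)
    finally show ?thesis using that by simp
  qed
  have Qv: "mat_app n Q v j = (if j = k then 1 else 0)" if "k \<le> j" "j < n" for j
  proof -
    have "mat_app n Q v j = mat_app n Q p j - (\<Sum>l<k. cinner n p (u l) * mat_app n Q (u l) j)"
      by (simp only: v_def mat_app_diff mat_app_sum)
    also have "(\<Sum>l<k. cinner n p (u l) * mat_app n Q (u l) j) = 0"
      using fl that by (intro sum.neutral) auto
    finally show ?thesis using Qp that by simp
  qed
  have Av: "mat_app n A v m = complex_of_real (e k) * v m" if "m < n" for m
  proof -
    \<comment> \<open>The defect \<open>y\<close> drops into the preceding space of the flag, and is orthogonal to it.\<close>
    define y where "y = (\<lambda>m. mat_app n A v m - complex_of_real (e k) * v m)"
    have "mat_app n Q y j = 0" if j: "k \<le> j" "j < n" for j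
    proof -
      have "mat_app n Q y j = mat_app n B (mat_app n Q v) j - complex_of_real (e k) * mat_app n Q v j"
        unfolding y_def mat_app_diff mat_app_scale using QA j by simp
      also have "mat_app n B (mat_app n Q v) j = (\<Sum>l<n. if l = k then B $$ (j,k) else 0)"
        unfolding mat_app_def[of n B]
      proof (rule sum.cong)
        fix l assume "l \<in> {..<n}"
        then have l: "l < n" by simp
        show "B $$ (j,l) * mat_app n Q v l = (if l = k then B $$ (j,k) else 0)"
        proof (cases "l < j")
          case True
          then have "B $$ (j,l) = 0" using up sw(5) j by (auto simp: upper_triangular_def)
          then show ?thesis by auto
        next
          case False
          then show ?thesis using Qv[of l] l j by auto
        qed
      qed simp
      also have "\<dots> = B $$ (j,k)" using k by simp
      also have "\<dots> = complex_of_real (e k) * mat_app n Q v j"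
      proof (cases "j = k")
        case True then show ?thesis using es[OF k] Qv[of k] k by simp
      next
        case False
        then have "B $$ (j,k) = 0" using up sw(5) j by (auto simp: upper_triangular_def)
        then show ?thesis using Qv[OF j] False by simp
      qed
      finally show ?thesis by simp
    qed
    then obtain c where c: "\<forall>m<n. y m = (\<Sum>i<k. c i * u i m)" using sp[of y] by blast
    have "c i = 0" if i: "i < k" for i
    proof -
      have "cinner n y (u i) = cinner n (\<lambda>m. \<Sum>l<k. c l * u l m) (u i)"
        by (rule cinner_cong) (use c in auto)
      also have "\<dots> = (\<Sum>l<k. if l = i then c l else 0)"
        unfolding cinner_sum by (rule sum.cong) (use on i in auto)
      also have "\<dots> = c i" using i by simp
      finally have "c i = cinner n y (u i)" ..
      also have "\<dots> = cinner n (mat_app n A v) (u i) - complex_of_real (e k) * cinner n v (u i)"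
        by (simp only: y_def cinner_diff cinner_scale)
      also have "cinner n (mat_app n A v) (u i) = cinner n v (mat_app n A (u i))"
        by (rule hermitian_cinner_swap[OF A H])
      also have "\<dots> = cinner n v (\<lambda>m. complex_of_real (e i) * u i m)"
        by (rule cinner_cong) (use ev i in auto)
      also have "\<dots> = complex_of_real (e i) * cinner n v (u i)"
        by (simp add: cinner_def sum_distrib_left mult_ac)
      finally show ?thesis using vu[OF i] by simp
    qed
    then have "y m = 0" using c that by simp
    then show ?thesis by (simp add: y_def)
  qed
  define N where "N = sqrt (sqnorm n v)"
  have "sqnorm n v \<noteq> 0"
  proof
    assume "sqnorm n v = 0"
    then have "mat_app n Q v k = mat_app n Q (\<lambda>_. 0) k" by (intro mat_app_cong) (auto simp: sqnorm_eq_0)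
    then show False using Qv[of k] k by (simp add: mat_app_def)
  qed
  then have N: "N > 0" "N\<^sup>2 = sqnorm n v"
    using sqnorm_nonneg[of n v] by (auto simp: N_def)
  define w where "w = (\<lambda>m. complex_of_real (1 / N) * v m)"
  define u' where "u' = u(k := w)"
  have ww: "cinner n w w = 1"
  proof -
    have "cinner n w w = complex_of_real (1 / N) * cnj (complex_of_real (1 / N) * cinner n v v)"
      unfolding w_def cinner_scale by (subst cinner_commute) (simp only: cinner_scale)
    also have "\<dots> = complex_of_real (1 / N * (1 / N) * N\<^sup>2)"
      unfolding cinner_self N(2)[symmetric] by (simp only: of_real_mult complex_cnj_mult complex_cnj_complex_of_real mult.assoc)
    also have "\<dots> = 1" using N(1) by (simp add: power2_eq_square)
    finally show ?thesis .
  qed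
  have wu: "cinner n w (u i) = 0" "cinner n (u i) w = 0" if "i < k" for i
  proof -
    show "cinner n w (u i) = 0" using vu[OF that] by (simp only: w_def cinner_scale mult_zero_right)
    then show "cinner n (u i) w = 0" by (subst cinner_commute) simp
  qed
  have "\<forall>i<Suc k. \<forall>j<Suc k. cinner n (u' i) (u' j) = (if i = j then 1 else 0)"
    using on ww wu by (auto simp: u'_def less_Suc_eq)
  moreover have "\<forall>i<Suc k. \<forall>m<n. mat_app n A (u' i) m = complex_of_real (e i) * u' i m"
  proof (intro allI impI)
    fix i m assume im: "i < Suc k" "m < n"
    show "mat_app n A (u' i) m = complex_of_real (e i) * u' i m"
    proof (cases "i = k")
      case True
      have "mat_app n A w m = complex_of_real (e k) * w m"
        unfolding w_def mat_app_scale Av[OF im(2)] by (simp only: mult_ac)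
      with True show ?thesis by (simp add: u'_def)
    next
      case False then show ?thesis using ev im by (simp add: u'_def)
    qed
  qed
  moreover have "\<forall>i<Suc k. \<forall>j. i < j \<and> j < n \<longrightarrow> mat_app n Q (u' i) j = 0"
  proof (intro allI impI)
    fix i j assume ij: "i < Suc k" "i < j \<and> j < n"
    show "mat_app n Q (u' i) j = 0"
    proof (cases "i = k")
      case True
      have "mat_app n Q w j = 0" unfolding w_def mat_app_scale using Qv[of j] ij True by simp
      with True show ?thesis by (simp add: u'_def)
    next
      case False then show ?thesis using fl ij by (simp add: u'_def)
    qed
  qed
  moreover have "\<exists>c. \<forall>m<n. x m = (\<Sum>i<Suc k. c i * u' i m)"
    if x: "\<forall>j. Suc k \<le> j \<and> j < n \<longrightarrow> mat_app n Q x j = 0" for x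
  proof -
    define a where "a = mat_app n Q x k"
    have "mat_app n Q (\<lambda>m. x m - a * v m) j = 0" if "k \<le> j" "j < n" for j
      unfolding mat_app_diff mat_app_scale using Qv[OF that] x that by (cases "j = k") (auto simp: a_def)
    then obtain c where c: "\<forall>m<n. x m - a * v m = (\<Sum>i<k. c i * u i m)"
      using sp[of "\<lambda>m. x m - a * v m"] by blast
    have "x m = (\<Sum>i<Suc k. (c(k := a * complex_of_real N)) i * u' i m)" if "m < n" for m
    proof -
      have "(\<Sum>i<k. (c(k := a * complex_of_real N)) i * u' i m) = (\<Sum>i<k. c i * u i m)"
        by (rule sum.cong) (auto simp: u'_def)
      moreover have "complex_of_real N * w m = v m"
        using N(1) by (simp add: w_def)
      moreover have "x m = (\<Sum>i<k. c i * u i m) + a * v m"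
        using c that by (metis diff_add_cancel)
      ultimately show ?thesis by (simp add: u'_def mult.assoc)
    qed
    then show ?thesis by blast
  qed
  ultimately show ?case by blast
qed

text \<open>
  The Schur decomposition accepts the eigenvalues in any order, so the sorted list can be prescribed
  as the diagonal and the eigenbasis comes out indexed by the sorted eigenvalues, with multiplicity.
\<close>

theorem hermitian_spectral:
  assumes A: "A \<in> carrier_mat n n" and H: "hermitian A"
  shows "\<exists>u. (\<forall>i<n. \<forall>j<n. cinner n (u i) (u j) = (if i = j then 1 else 0))
    \<and> (\<forall>i<n. \<forall>m<n. mat_app n A (u i) m = complex_of_real (eig (Suc i) A) * u i m)
    \<and> (\<forall>x. \<exists>c. \<forall>m<n. x m = (\<Sum>i<n. c i * u i m))"
proof -
  define es where "es = map complex_of_real (sorted_eigenvalues A)"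
  obtain B P Q where S: "schur_decomposition A es = (B, P, Q)"
    by (metis prod_cases3)
  have "char_poly A = (\<Prod>e\<leftarrow>es. [:- e, 1:])"
    using sorted_eigenvalues_hermitian(3)[OF A H] by (simp add: es_def o_def)
  from schur_decomposition[OF A this S]
  have W: "similar_mat_wit A B P Q" and up: "upper_triangular B" and d: "diag_mat B = es" by auto
  have B: "B \<in> carrier_mat n n" using similar_mat_witD2[OF A W] by simp
  have "B $$ (k,k) = complex_of_real (eig (Suc k) A)" if k: "k < n" for k
  proof -
    have "diag_mat B ! k = B $$ (k,k)" using B k by (simp add: diag_mat_def)
    then show ?thesis
      using k sorted_eigenvalues_hermitian(2)[OF A H] by (simp add: d es_def eig_def)
  qed
  from eigenvector_flag[OF A H W up this order.refl] obtain u where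
    "\<forall>i<n. \<forall>j<n. cinner n (u i) (u j) = (if i = j then 1 else 0)"
    "\<forall>i<n. \<forall>m<n. mat_app n A (u i) m = complex_of_real (eig (Suc i) A) * u i m"
    "\<forall>x. (\<forall>j. n \<le> j \<and> j < n \<longrightarrow> mat_app n Q x j = 0) \<longrightarrow> (\<exists>c. \<forall>m<n. x m = (\<Sum>i<n. c i * u i m))"
    by blast
  moreover have "\<not> (n \<le> j \<and> j < n)" for j by auto
  ultimately show ?thesis by (intro exI[of _ u] conjI) simp_all
qed

section \<open>Rayleigh quotients and interlacing\<close>

lemma eig_mono:
  assumes A: "A \<in> carrier_mat n n" and H: "hermitian A" and "1 \<le> i" "i \<le> j" "j \<le> n"
  shows "eig i A \<le> eig j A"
  unfolding eig_def using assms sorted_eigenvalues_hermitian[OF A H]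
  by (intro sorted_nth_mono) auto

lemma orthonormal_combination:
  fixes k n :: nat
  assumes A: "A \<in> carrier_mat n n"
    and on: "\<And>i j. i < k \<Longrightarrow> j < k \<Longrightarrow> cinner n (u i) (u j) = (if i = j then 1 else 0)"
    and ev: "\<And>i m. i < k \<Longrightarrow> m < n \<Longrightarrow> mat_app n A (u i) m = complex_of_real (e i) * u i m"
    and x: "\<And>m. m < n \<Longrightarrow> x m = (\<Sum>i<k. c i * u i m)"
  shows "sqnorm n x = (\<Sum>i<k. (cmod (c i))\<^sup>2)" and "quad_form A x = (\<Sum>i<k. e i * (cmod (c i))\<^sup>2)"
proof -
  have ux: "cinner n (u i) x = cnj (c i)" if i: "i < k" for i
  proof -
    have "cinner n x (u i) = cinner n (\<lambda>m. \<Sum>l<k. c l * u l m) (u i)"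
      by (rule cinner_cong) (auto simp: x)
    also have "\<dots> = (\<Sum>l<k. if l = i then c l else 0)"
      unfolding cinner_sum by (rule sum.cong) (use on i in auto)
    also have "\<dots> = c i" using i by simp
    finally show ?thesis by (subst cinner_commute) simp
  qed
  have "cinner n x x = cinner n (\<lambda>m. \<Sum>l<k. c l * u l m) x"
    by (rule cinner_cong) (auto simp: x)
  also have "\<dots> = (\<Sum>i<k. complex_of_real ((cmod (c i))\<^sup>2))"
    unfolding cinner_sum by (rule sum.cong) (use ux in \<open>auto simp only: complex_norm_square lessThan_iff\<close>)
  finally have "complex_of_real (sqnorm n x) = complex_of_real (\<Sum>i<k. (cmod (c i))\<^sup>2)"
    by (simp only: cinner_self of_real_sum)
  then show "sqnorm n x = (\<Sum>i<k. (cmod (c i))\<^sup>2)" by (simp only: of_real_eq_iff)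
  have "mat_app n A x m = (\<Sum>i<k. (c i * complex_of_real (e i)) * u i m)" if "m < n" for m
  proof -
    have "mat_app n A x m = mat_app n A (\<lambda>m. \<Sum>l<k. c l * u l m) m"
      by (rule mat_app_cong) (auto simp: x)
    also have "\<dots> = (\<Sum>i<k. (c i * complex_of_real (e i)) * u i m)"
      unfolding mat_app_sum by (rule sum.cong) (use ev that in auto)
    finally show ?thesis .
  qed
  then have "cinner n (mat_app n A x) x = cinner n (\<lambda>m. \<Sum>i<k. (c i * complex_of_real (e i)) * u i m) x"
    by (intro cinner_cong) auto
  also have "\<dots> = (\<Sum>i<k. complex_of_real (e i * (cmod (c i))\<^sup>2))"
    unfolding cinner_sum
    by (rule sum.cong) (auto simp: ux complex_norm_square mult_ac simp del: of_real_power)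
  finally show "quad_form A x = (\<Sum>i<k. e i * (cmod (c i))\<^sup>2)"
    using A by (simp add: quad_form_def)
qed

lemma eig_1_le_rayleigh:
  assumes A: "A \<in> carrier_mat n n" and H: "hermitian A"
  shows "eig 1 A * sqnorm n x \<le> quad_form A x"
proof -
  obtain u where u: "\<forall>i<n. \<forall>j<n. cinner n (u i) (u j) = (if i = j then 1 else 0)"
    "\<forall>i<n. \<forall>m<n. mat_app n A (u i) m = complex_of_real (eig (Suc i) A) * u i m"
    "\<forall>x. \<exists>c. \<forall>m<n. x m = (\<Sum>i<n. c i * u i m)"
    using hermitian_spectral[OF A H] by blast
  note on = u(1)[rule_format] and ev = u(2)[rule_format]
  obtain c where "\<forall>m<n. x m = (\<Sum>i<n. c i * u i m)" using u(3) by blast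
  then have c: "sqnorm n x = (\<Sum>i<n. (cmod (c i))\<^sup>2)"
    "quad_form A x = (\<Sum>i<n. eig (Suc i) A * (cmod (c i))\<^sup>2)"
    using orthonormal_combination[OF A on ev, of n x c] by auto
  show ?thesis unfolding c sum_distrib_left
    by (intro sum_mono mult_right_mono eig_mono[OF A H]) auto
qed

text \<open>
  Transfers any bound on the quadratic form that is uniform in the vector to every eigenvalue.
\<close>

lemma eig_attained:
  assumes A: "A \<in> carrier_mat n n" and H: "hermitian A" and j: "1 \<le> j" "j \<le> n"
  shows "\<exists>x. sqnorm n x = 1 \<and> quad_form A x = eig j A"
proof -
  obtain u where u: "\<forall>i<n. \<forall>j<n. cinner n (u i) (u j) = (if i = j then 1 else 0)"
    "\<forall>i<n. \<forall>m<n. mat_app n A (u i) m = complex_of_real (eig (Suc i) A) * u i m"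
    using hermitian_spectral[OF A H] by blast
  note on = u(1)[rule_format] and ev = u(2)[rule_format]
  define i where "i = j - 1"
  have i: "i < n" "Suc i = j" using j by (auto simp: i_def)
  have "sqnorm n (u i) = (\<Sum>l<n. if l = i then 1 else 0)"
    "quad_form A (u i) = (\<Sum>l<n. if l = i then eig (Suc i) A else 0)"
    using orthonormal_combination[OF A on ev, of n "u i" "\<lambda>l. if l = i then 1 else 0"] i(1)
    by (auto simp: if_distrib[of "\<lambda>c. c * _"] if_distrib[of "\<lambda>c. _ * c"] if_distrib[of cmod] if_distrib[of "\<lambda>c. c\<^sup>2"] cong: if_cong)
  then show ?thesis using i by (intro exI[of _ "u i"]) auto
qed

text \<open>
  The form of the south-east block is the restriction of the form of \<open>A\<close> to the vectors whose first
  component vanishes.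
\<close>

lemma quad_form_south_east:
  assumes A: "A \<in> carrier_mat n n" and n: "n \<ge> 1" and x: "x 0 = 0"
  shows "quad_form (south_east A) (\<lambda>i. x (Suc i)) = quad_form A x"
    and "sqnorm (n - 1) (\<lambda>i. x (Suc i)) = sqnorm n x"
proof -
  obtain k where k: "n = Suc k" using n by (cases n) auto
  have d: "dim_row A = Suc k" "dim_col A = Suc k" using A k by auto
  show "quad_form (south_east A) (\<lambda>i. x (Suc i)) = quad_form A x"
    using x by (simp add: quad_form_def south_east_def d cinner_def mat_app_def sum.lessThan_Suc_shift del: sum.lessThan_Suc)
  show "sqnorm (n - 1) (\<lambda>i. x (Suc i)) = sqnorm n x"
    using x by (simp add: sqnorm_def k sum.lessThan_Suc_shift del: sum.lessThan_Suc)
qed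

text \<open>
  The plane spanned by the eigenvectors of the two smallest eigenvalues contains a nonzero vector
  with vanishing first component. Its Rayleigh quotient is at most \<open>\<lambda>\<^sub>2(A)\<close>, and, seen as a vector for
  the south-east block, at least the smallest eigenvalue of that block.
\<close>

lemma south_east_interlacing:
  assumes A: "A \<in> carrier_mat n n" and H: "hermitian A" and n: "n \<ge> 2"
  shows "eig 1 (south_east A) \<le> eig 2 A"
proof -
  obtain u where u: "\<forall>i<n. \<forall>j<n. cinner n (u i) (u j) = (if i = j then 1 else 0)"
    "\<forall>i<n. \<forall>m<n. mat_app n A (u i) m = complex_of_real (eig (Suc i) A) * u i m"
    using hermitian_spectral[OF A H] by blast
  note on = u(1)[rule_format] and ev = u(2)[rule_format]
  \<comment> \<open>If both eigenvectors already have first component 0, any nonzero combination serves.\<close>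
  define a where "a = (if u 0 0 = 0 \<and> u 1 0 = 0 then 1 else u 1 0)"
  define b where "b = - u 0 0"
  define c where "c = (\<lambda>i::nat. if i = 0 then a else b)"
  define x where "x = (\<lambda>m. \<Sum>i<2. c i * u i m)"
  have x0: "x 0 = 0" by (auto simp: x_def c_def a_def b_def numeral_2_eq_2)
  have se: "quad_form (south_east A) (\<lambda>i. x (Suc i)) = quad_form A x"
    "sqnorm (n - 1) (\<lambda>i. x (Suc i)) = sqnorm n x"
    using quad_form_south_east[of A n x] A x0 n by auto
  have "(a, b) \<noteq> (0, 0)" by (auto simp: a_def b_def)
  then have pos: "(cmod a)\<^sup>2 + (cmod b)\<^sup>2 > 0" by (auto simp: sum_power2_gt_zero_iff)
  have s: "sqnorm n x = (cmod a)\<^sup>2 + (cmod b)\<^sup>2"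
    and q: "quad_form A x = eig 1 A * (cmod a)\<^sup>2 + eig 2 A * (cmod b)\<^sup>2"
    using orthonormal_combination[OF A, of 2 u "\<lambda>i. eig (Suc i) A" x c] u n
    by (auto simp: x_def c_def numeral_2_eq_2)
  have "eig 1 (south_east A) * sqnorm n x \<le> quad_form A x"
    using eig_1_le_rayleigh[OF south_east_hermitian[OF A H], of "\<lambda>i. x (Suc i)"] se n by simp
  also have "\<dots> \<le> eig 2 A * (cmod a)\<^sup>2 + eig 2 A * (cmod b)\<^sup>2"
    unfolding q using n by (intro add_mono mult_right_mono eig_mono[OF A H]) auto
  also have "\<dots> = eig 2 A * sqnorm n x" by (simp add: s distrib_left)
  finally show ?thesis using pos s by simp
qed

section \<open>The energy of the interpolating polynomial\<close>

text \<open>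
  Cauchy-Schwarz for \<open>p(x) - p(0) = \<integral>\<^sub>0\<^sup>x p'\<close>. With \<open>d = p(x) - p(0)\<close>, integrate the pointwise
  inequality \<open>2 d p' - d\<^sup>2 \<le> p'\<^sup>2\<close> over \<open>[0, x]\<close> and use \<open>x \<le> 1\<close>.
\<close>

lemma poly_oscillation_le_energy:
  fixes p :: "real poly"
  assumes x: "x \<in> {0..1}"
  shows "(poly p x - poly p 0)\<^sup>2 \<le> integral {0..1} (\<lambda>t. (poly (pderiv p) t)\<^sup>2)"
proof -
  define d where "d = poly p x - poly p 0"
  have int: "(\<lambda>t. (poly (pderiv p) t)\<^sup>2) integrable_on {0..y}" for y
    by (intro integrable_continuous_real continuous_intros)
  have "((\<lambda>t. 2 * d * poly (pderiv p) t - d\<^sup>2) has_integral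
          (2 * d * poly p x - d\<^sup>2 * x) - (2 * d * poly p 0 - d\<^sup>2 * 0)) {0..x}"
    using x by (intro fundamental_theorem_of_calculus)
      (auto intro!: derivative_eq_intros poly_DERIV simp: has_real_derivative_iff_has_vector_derivative[symmetric])
  then have lin: "((\<lambda>t. 2 * d * poly (pderiv p) t - d\<^sup>2) has_integral 2 * d\<^sup>2 - d\<^sup>2 * x) {0..x}"
    by (simp add: d_def power2_eq_square algebra_simps)
  have "d\<^sup>2 * x \<le> d\<^sup>2" using x by (simp add: mult_left_le)
  then have "d\<^sup>2 \<le> 2 * d\<^sup>2 - d\<^sup>2 * x" by simp
  also have "\<dots> \<le> integral {0..x} (\<lambda>t. (poly (pderiv p) t)\<^sup>2)"
  proof (rule has_integral_le[OF lin integrable_integral[OF int]])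
    show "2 * d * poly (pderiv p) t - d\<^sup>2 \<le> (poly (pderiv p) t)\<^sup>2" for t
      using zero_le_power2[of "poly (pderiv p) t - d"] by (simp add: power2_diff mult_ac)
  qed
  also have "\<dots> \<le> integral {0..1} (\<lambda>t. (poly (pderiv p) t)\<^sup>2)"
    using x by (intro integral_subset_le int) auto
  finally show ?thesis by (simp add: d_def)
qed

lemma nodal_basis:
  assumes "inj_on \<xi> {1..r+1}" and "j \<in> {1..r+1}"
  shows "degree (nodal_basis r \<xi> j) \<le> r"
    and "i \<in> {1..r+1} \<Longrightarrow> poly (nodal_basis r \<xi> j) (\<xi> i) = (if i = j then 1 else 0)"
  using theI'[OF nodal_basis_ex1[OF assms]] unfolding nodal_basis_def by auto

definition stiffness_form :: "nat \<Rightarrow> (nat \<Rightarrow> real) \<Rightarrow> (nat \<Rightarrow> real) \<Rightarrow> real" where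
  "stiffness_form r \<xi> a = (\<Sum>i\<le>r. \<Sum>j\<le>r. local_stiffness r \<xi> $$ (i,j) * (a i * a j))"

definition lagrange_interpolant :: "nat \<Rightarrow> (nat \<Rightarrow> real) \<Rightarrow> (nat \<Rightarrow> real) \<Rightarrow> real poly" where
  "lagrange_interpolant r \<xi> a = (\<Sum>j\<le>r. smult (a j) (nodal_basis r \<xi> (j+1)))"

lemma lagrange_interpolant:
  assumes inj: "inj_on \<xi> {1..r+1}"
  shows "degree (lagrange_interpolant r \<xi> a) \<le> r"
    and "i \<le> r \<Longrightarrow> poly (lagrange_interpolant r \<xi> a) (\<xi> (i+1)) = a i"
proof -
  have "degree (smult (a j) (nodal_basis r \<xi> (j+1))) \<le> r" if "j \<le> r" for j
    by (rule order.trans[OF degree_smult_le nodal_basis(1)[OF inj]]) (use that in simp)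
  then show "degree (lagrange_interpolant r \<xi> a) \<le> r"
    unfolding lagrange_interpolant_def by (intro degree_sum_le) simp_all
  assume i: "i \<le> r"
  have "a j * poly (nodal_basis r \<xi> (j+1)) (\<xi> (i+1)) = (if i = j then a j else 0)" if "j \<le> r" for j
    using nodal_basis(2)[OF inj, of "j+1" "i+1"] that i by simp
  then have "poly (lagrange_interpolant r \<xi> a) (\<xi> (i+1)) = (\<Sum>j\<le>r. if i = j then a j else 0)"
    unfolding lagrange_interpolant_def poly_sum poly_smult by (intro sum.cong) simp_all
  then show "poly (lagrange_interpolant r \<xi> a) (\<xi> (i+1)) = a i" using i by simp
qed

lemma lagrange_interpolant_unique:
  assumes inj: "inj_on \<xi> {1..r+1}" and deg: "degree p \<le> r"
    and a: "\<And>i. i \<le> r \<Longrightarrow> poly p (\<xi> (i+1)) = a i"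
  shows "p = lagrange_interpolant r \<xi> a"
proof (rule poly_eqI_degree[of "\<xi> ` {1..r+1}"])
  fix y assume "y \<in> \<xi> ` {1..r+1}"
  then obtain i where i: "i \<in> {1..r+1}" "y = \<xi> i" by auto
  then obtain k where "i = k + 1" "k \<le> r" by (cases i) auto
  then show "poly p y = poly (lagrange_interpolant r \<xi> a) y"
    using a lagrange_interpolant(2)[OF inj] i by simp
next
  have "card (\<xi> ` {1..r+1}) = r + 1" using card_image[OF inj] by simp
  then show "degree p < card (\<xi> ` {1..r+1})"
    and "degree (lagrange_interpolant r \<xi> a) < card (\<xi> ` {1..r+1})"
    using deg lagrange_interpolant(1)[OF inj, of a] by linarith+
qed

lemma stiffness_form_eq_energy:
  assumes inj: "inj_on \<xi> {1..r+1}" and deg: "degree p \<le> r"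
    and a: "\<And>i. i \<le> r \<Longrightarrow> poly p (\<xi> (i+1)) = a i"
  shows "stiffness_form r \<xi> a = integral {0..1} (\<lambda>t. (poly (pderiv p) t)\<^sup>2)"
proof -
  define \<psi> where "\<psi> = (\<lambda>j. poly (pderiv (nodal_basis r \<xi> (j+1))))"
  have int: "(\<lambda>t. \<psi> i t * \<psi> j t) integrable_on {0..1}" for i j
    unfolding \<psi>_def by (intro integrable_continuous_real continuous_intros)
  have "p = lagrange_interpolant r \<xi> a"
    by (rule lagrange_interpolant_unique[OF inj deg a])
  then have "poly (pderiv p) t = (\<Sum>j\<le>r. a j * \<psi> j t)" for t
    by (simp add: lagrange_interpolant_def \<psi>_def pderiv_sum pderiv_smult poly_sum)
  then have "(poly (pderiv p) t)\<^sup>2 = (\<Sum>i\<le>r. \<Sum>j\<le>r. (a i * a j) * (\<psi> i t * \<psi> j t))" for t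
    by (simp add: power2_eq_square sum_product mult_ac)
  then have "integral {0..1} (\<lambda>t. (poly (pderiv p) t)\<^sup>2) =
      integral {0..1} (\<lambda>t. \<Sum>i\<le>r. \<Sum>j\<le>r. (a i * a j) * (\<psi> i t * \<psi> j t))"
    by simp
  also have "\<dots> = (\<Sum>i\<le>r. \<Sum>j\<le>r. (a i * a j) * integral {0..1} (\<lambda>t. \<psi> i t * \<psi> j t))"
    by (intro integral_unique has_integral_sum has_integral_mult_right integrable_integral int finite_atMost)
  also have "\<dots> = stiffness_form r \<xi> a"
    by (simp add: stiffness_form_def local_stiffness_def \<psi>_def mult_ac)
  finally show ?thesis ..
qed

text \<open>
  Coercivity modulo constants, which are the kernel of the stiffness matrix: the first node is the
  left end point of the interval, so the oscillation bound applies from there to every other node.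
\<close>

lemma stiffness_form_oscillation:
  assumes inj: "inj_on \<xi> {1..r+1}" and nodes: "\<xi> ` {1..r+1} \<subseteq> {0..1}" and "\<xi> 1 = 0" and i: "i \<le> r"
  shows "(a i - a 0)\<^sup>2 \<le> stiffness_form r \<xi> a"
proof -
  let ?p = "lagrange_interpolant r \<xi> a"
  have "(poly ?p (\<xi> (i+1)) - poly ?p 0)\<^sup>2 \<le> integral {0..1} (\<lambda>t. (poly (pderiv ?p) t)\<^sup>2)"
    using nodes i by (intro poly_oscillation_le_energy) (auto simp: image_subset_iff)
  also have "\<dots> = stiffness_form r \<xi> a"
    by (rule stiffness_form_eq_energy[OF inj, symmetric]) (use lagrange_interpolant[OF inj] in auto)
  finally show ?thesis
    using lagrange_interpolant(2)[OF inj, of i a] lagrange_interpolant(2)[OF inj, of 0 a] i \<open>\<xi> 1 = 0\<close>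
    by simp
qed

text \<open>
  The interpolating polynomial is \<open>c + t \<phi>\<^sub>r\<^sub>+\<^sub>1\<close>, and the constant has no energy.
\<close>

lemma stiffness_form_const_plus_hat:
  assumes inj: "inj_on \<xi> {1..r+1}"
  shows "stiffness_form r \<xi> (\<lambda>i. if i < r then c else c + t) = t\<^sup>2 * local_stiffness r \<xi> $$ (r,r)"
proof -
  let ?\<phi> = "nodal_basis r \<xi> (r+1)"
  let ?p = "[:c:] + smult t ?\<phi>"
  have "degree ?p \<le> r"
    by (intro degree_add_le order.trans[OF degree_smult_le nodal_basis(1)[OF inj]]) simp_all
  moreover have "poly ?p (\<xi> (i+1)) = (if i < r then c else c + t)" if "i \<le> r" for i
    using nodal_basis(2)[OF inj, of "r+1" "i+1"] that by auto
  ultimately have "stiffness_form r \<xi> (\<lambda>i. if i < r then c else c + t)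
      = integral {0..1} (\<lambda>x. (poly (pderiv ?p) x)\<^sup>2)"
    by (rule stiffness_form_eq_energy[OF inj])
  also have "\<dots> = integral {0..1} (\<lambda>x. t\<^sup>2 * (poly (pderiv ?\<phi>) x * poly (pderiv ?\<phi>) x))"
    by (simp add: pderiv_add pderiv_smult pderiv_pCons power2_eq_square mult_ac)
  also have "\<dots> = t\<^sup>2 * local_stiffness r \<xi> $$ (r,r)"
    by (simp add: local_stiffness_def)
  finally show ?thesis .
qed

lemma stiffness_form_le:
  "stiffness_form r \<xi> a \<le> (\<Sum>i\<le>r. \<Sum>j\<le>r. \<bar>local_stiffness r \<xi> $$ (i,j)\<bar>) * (\<Sum>i\<le>r. (a i)\<^sup>2)"
proof -
  have sq: "(a i)\<^sup>2 \<le> (\<Sum>i\<le>r. (a i)\<^sup>2)" if "i \<le> r" for i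
    using that by (intro member_le_sum) auto
  have "\<bar>a i * a j\<bar> \<le> (\<Sum>i\<le>r. (a i)\<^sup>2)" if "i \<le> r" "j \<le> r" for i j
  proof -
    have "2 * \<bar>a i * a j\<bar> \<le> (a i)\<^sup>2 + (a j)\<^sup>2"
      using sum_squares_bound[of "\<bar>a i\<bar>" "\<bar>a j\<bar>"] by (simp add: abs_mult)
    then show ?thesis using sq[OF that(1)] sq[OF that(2)] by linarith
  qed
  then have "local_stiffness r \<xi> $$ (i,j) * (a i * a j)
      \<le> \<bar>local_stiffness r \<xi> $$ (i,j)\<bar> * (\<Sum>i\<le>r. (a i)\<^sup>2)" if "i \<le> r" "j \<le> r" for i j
  proof -
    have "local_stiffness r \<xi> $$ (i,j) * (a i * a j) \<le> \<bar>local_stiffness r \<xi> $$ (i,j)\<bar> * \<bar>a i * a j\<bar>"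
      by (simp only: abs_mult[symmetric] abs_ge_self)
    also have "\<dots> \<le> \<bar>local_stiffness r \<xi> $$ (i,j)\<bar> * (\<Sum>i\<le>r. (a i)\<^sup>2)"
      using that by (intro mult_left_mono \<open>\<And>i j. i \<le> r \<Longrightarrow> j \<le> r \<Longrightarrow> \<bar>a i * a j\<bar> \<le> (\<Sum>i\<le>r. (a i)\<^sup>2)\<close>) auto
    finally show ?thesis .
  qed
  then show ?thesis
    unfolding stiffness_form_def sum_distrib_right by (intro sum_mono) auto
qed

section \<open>The symbol as the energy of a quasi-periodic function\<close>

text \<open>
  The nodal values on one cell of a function whose values on consecutive cells differ by the phase
  \<open>e\<^sup>-\<^sup>i\<^sup>\<theta>\<close>: the right end point of a cell is the left end point of the next one.
\<close>

definition bloch_extension :: "nat \<Rightarrow> real \<Rightarrow> (nat \<Rightarrow> complex) \<Rightarrow> nat \<Rightarrow> complex" where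
  "bloch_extension r \<theta> u i = (if i < r then u i else cis (- \<theta>) * u 0)"

lemma symbol_entry:
  assumes "i < r" "j < r"
  shows "symbol r \<xi> \<theta> $$ (i,j) = local_stiffness r \<xi> $$ (i,j)
      + (if i = 0 then (if j = 0 then local_stiffness r \<xi> $$ (r,r) else 0) else 0)
      + (if i = 0 then cis \<theta> * local_stiffness r \<xi> $$ (r,j) else 0)
      + (if j = 0 then cis (- \<theta>) * local_stiffness r \<xi> $$ (i,r) else 0)"
proof -
  have e: "exp (\<i> * complex_of_real \<theta>) = cis \<theta>" "exp (- (\<i> * complex_of_real \<theta>)) = cis (- \<theta>)"
    unfolding cis_conv_exp by (simp_all only: of_real_minus mult_minus_right)
  have "local_stiffness r \<xi> $$ (r,i) = local_stiffness r \<xi> $$ (i,r)"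
    using assms by (simp add: local_stiffness_def mult.commute)
  then show ?thesis
    using assms by (auto simp: symbol_def alpha_block_def beta_block_def beta_row_def assembled_stiffness_def e)
qed

text \<open>
  Assembling the cells identifies the last local node with the first node of the next cell. Hence the
  local form at the extension \<open>U\<close> reproduces the symbol: \<open>K\<^sub>r\<^sub>r\<close> lands on the entry \<open>(0,0)\<close>, the rest
  of the last row on row 0 with factor \<open>e\<^sup>i\<^sup>\<theta>\<close>, and the rest of the last column on column 0 with factor
  \<open>e\<^sup>-\<^sup>i\<^sup>\<theta>\<close>. Since the local matrix \<open>K\<close> is real and symmetric, its Hermitian form splits into real
  and imaginary parts.
\<close>

lemma quad_form_symbol:
  fixes \<theta> :: real
  assumes r: "r > 0"
  defines "U \<equiv> bloch_extension r \<theta>"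
  shows "quad_form (symbol r \<xi> \<theta>) u
    = stiffness_form r \<xi> (\<lambda>i. Re (U u i)) + stiffness_form r \<xi> (\<lambda>i. Im (U u i))"
proof -
  define K where "K i j = complex_of_real (local_stiffness r \<xi> $$ (i,j))" for i j
  \<comment> \<open>\<open>L = K U\<close>; row 0 of the symbol collects the rows 0 and \<open>r\<close> of \<open>K U\<close>, the latter with phase \<open>e\<^sup>i\<^sup>\<theta>\<close>.\<close>
  define L where "L i = (\<Sum>j\<le>r. K i j * U u j)" for i
  have L: "L i = (\<Sum>j<r. K i j * u j) + K i r * cis (- \<theta>) * u 0" for i
    by (simp add: L_def U_def bloch_extension_def lessThan_Suc_atMost[symmetric])
  have cis: "cis \<theta> * (cis (- \<theta>) * z) = z" for z
    by (simp add: mult.assoc[symmetric] cis_mult)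
  have row: "mat_app r (symbol r \<xi> \<theta>) u i = L i + (if i = 0 then cis \<theta> * L r else 0)" if i: "i < r" for i
  proof -
    have "mat_app r (symbol r \<xi> \<theta>) u i = (\<Sum>j<r. K i j * u j
        + (if j = 0 then (if i = 0 then K r r else 0) * u 0 else 0)
        + (if i = 0 then cis \<theta> else 0) * (K r j * u j)
        + (if j = 0 then cis (- \<theta>) * K i r * u 0 else 0))"
      unfolding mat_app_def
      by (rule sum.cong) (use i in \<open>auto simp: symbol_entry K_def algebra_simps\<close>)
    also have "\<dots> = (\<Sum>j<r. K i j * u j) + (if i = 0 then K r r else 0) * u 0
        + (if i = 0 then cis \<theta> else 0) * (\<Sum>j<r. K r j * u j) + cis (- \<theta>) * K i r * u 0"
      using r by (simp add: sum.distrib sum_distrib_left)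
    also have "\<dots> = L i + (if i = 0 then cis \<theta> * L r else 0)"
      by (simp add: L algebra_simps cis)
    finally show ?thesis .
  qed
  have "cinner r (mat_app r (symbol r \<xi> \<theta>) u) u
      = (\<Sum>i<r. L i * cnj (u i) + (if i = 0 then cis \<theta> * L r * cnj (u 0) else 0))"
    unfolding cinner_def by (rule sum.cong) (auto simp: row algebra_simps)
  also have "\<dots> = (\<Sum>i<r. L i * cnj (u i)) + cis \<theta> * L r * cnj (u 0)"
    using r by (simp add: sum.distrib)
  also have "\<dots> = (\<Sum>i\<le>r. L i * cnj (U u i))"
    by (simp add: U_def bloch_extension_def lessThan_Suc_atMost[symmetric] cis_cnj mult_ac)
  also have "\<dots> = (\<Sum>i\<le>r. \<Sum>j\<le>r. K i j * (U u j * cnj (U u i)))"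
    by (simp add: L_def sum_distrib_right mult.assoc)
  finally have "cinner r (mat_app r (symbol r \<xi> \<theta>) u) u
      = (\<Sum>i\<le>r. \<Sum>j\<le>r. K i j * (U u j * cnj (U u i)))" .
  moreover have "dim_row (symbol r \<xi> \<theta>) = r" using symbol_carrier[of r \<xi> \<theta>] by simp
  moreover have "Re (K i j * (U u j * cnj (U u i))) = local_stiffness r \<xi> $$ (i,j) * (Re (U u i) * Re (U u j))
      + local_stiffness r \<xi> $$ (i,j) * (Im (U u i) * Im (U u j))" for i j
    by (simp add: K_def algebra_simps)
  ultimately show ?thesis
    by (simp only: quad_form_def stiffness_form_def Re_sum sum.distrib)
qed

section \<open>Bounds on the eigenvalues of the symbol\<close>

lemma cmod_cis_minus_1: "(cmod (cis (- \<theta>) - 1))\<^sup>2 = 2 - 2 * cos \<theta>"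
proof -
  have "(cmod (cis (- \<theta>) - 1))\<^sup>2 = (cos \<theta>)\<^sup>2 + (sin \<theta>)\<^sup>2 + 1 - 2 * cos \<theta>"
    by (simp add: cmod_power2 power2_diff)
  then show ?thesis by simp
qed

context
  fixes r :: nat and \<xi> :: "nat \<Rightarrow> real"
  assumes r: "r \<ge> 2" and inj: "inj_on \<xi> {1..r+1}"
    and nodes: "\<xi> ` {1..r+1} \<subseteq> {0..1}" and left: "\<xi> 1 = 0"
begin

lemma symbol_oscillation:
  fixes \<theta> :: real and u :: "nat \<Rightarrow> complex"
  assumes i: "i \<le> r"
  defines "U \<equiv> bloch_extension r \<theta> u"
  shows "(cmod (U i - U 0))\<^sup>2 \<le> quad_form (symbol r \<xi> \<theta>) u"
  using stiffness_form_oscillation[OF inj nodes left i, of "\<lambda>i. Re (U i)"]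
    stiffness_form_oscillation[OF inj nodes left i, of "\<lambda>i. Im (U i)"] r
  by (simp add: cmod_power2 quad_form_symbol U_def)

text \<open>
  Write \<open>q\<close> for the form at \<open>u\<close> and \<open>w = 2 - 2 cos \<theta> \<le> 4\<close>. The jump across the cell gives
  \<open>w \<bar>u\<^sub>0\<bar>\<^sup>2 \<le> q\<close> and the oscillation gives \<open>\<bar>u\<^sub>i - u\<^sub>0\<bar>\<^sup>2 \<le> q\<close>, so that
  \<open>w \<bar>u\<^sub>i\<bar>\<^sup>2 \<le> 2 w \<bar>u\<^sub>i - u\<^sub>0\<bar>\<^sup>2 + 2 w \<bar>u\<^sub>0\<bar>\<^sup>2 \<le> 8 q + 2 q\<close>.
\<close>

lemma symbol_coercive:
  "(2 - 2 * cos \<theta>) * sqnorm r u \<le> 10 * r * quad_form (symbol r \<xi> \<theta>) u"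
proof -
  let ?q = "quad_form (symbol r \<xi> \<theta>) u" and ?w = "2 - 2 * cos \<theta>"
  have w: "0 \<le> ?w" "?w \<le> 4" using cos_le_one[of \<theta>] cos_ge_minus_one[of \<theta>] by linarith+
  have "bloch_extension r \<theta> u r - bloch_extension r \<theta> u 0 = (cis (- \<theta>) - 1) * u 0"
    using r by (simp add: bloch_extension_def algebra_simps)
  then have jump: "?w * (cmod (u 0))\<^sup>2 \<le> ?q"
    using symbol_oscillation[of r \<theta> u]
    by (simp only: norm_mult power_mult_distrib cmod_cis_minus_1 order.refl)
  have "?w * (cmod (u i))\<^sup>2 \<le> 10 * ?q" if i: "i < r" for i
  proof -
    have osc: "(cmod (u i - u 0))\<^sup>2 \<le> ?q"
      using symbol_oscillation[of i \<theta> u] i r by (simp add: bloch_extension_def)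
    have "cmod (u i) \<le> cmod (u i - u 0) + cmod (u 0)"
      using norm_triangle_ineq[of "u i - u 0" "u 0"] by simp
    then have "(cmod (u i))\<^sup>2 \<le> (cmod (u i - u 0) + cmod (u 0))\<^sup>2"
      by (intro power_mono) auto
    also have "\<dots> \<le> 2 * (cmod (u i - u 0))\<^sup>2 + 2 * (cmod (u 0))\<^sup>2"
      using sum_squares_bound[of "cmod (u i - u 0)" "cmod (u 0)"] by (simp add: power2_sum)
    finally have "?w * (cmod (u i))\<^sup>2 \<le> ?w * (2 * (cmod (u i - u 0))\<^sup>2 + 2 * (cmod (u 0))\<^sup>2)"
      using w(1) by (rule mult_left_mono)
    also have "\<dots> = 2 * (?w * (cmod (u i - u 0))\<^sup>2) + 2 * (?w * (cmod (u 0))\<^sup>2)"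
      by (simp add: algebra_simps)
    also have "\<dots> \<le> 2 * (4 * ?q) + 2 * ?q"
      using w osc jump by (intro add_mono mult_left_mono mult_mono) auto
    finally show ?thesis by simp
  qed
  then have "(\<Sum>i<r. ?w * (cmod (u i))\<^sup>2) \<le> (\<Sum>i<r. 10 * ?q)"
    by (intro sum_mono) auto
  then show ?thesis by (simp add: sqnorm_def sum_distrib_left mult_ac)
qed

lemma symbol_bounded:
  "quad_form (symbol r \<xi> \<theta>) u \<le> 2 * (\<Sum>i\<le>r. \<Sum>j\<le>r. \<bar>local_stiffness r \<xi> $$ (i,j)\<bar>) * sqnorm r u"
proof -
  let ?B = "\<Sum>i\<le>r. \<Sum>j\<le>r. \<bar>local_stiffness r \<xi> $$ (i,j)\<bar>" and ?U = "bloch_extension r \<theta> u"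
  have "quad_form (symbol r \<xi> \<theta>) u \<le> ?B * (\<Sum>i\<le>r. (Re (?U i))\<^sup>2) + ?B * (\<Sum>i\<le>r. (Im (?U i))\<^sup>2)"
    using r by (simp only: quad_form_symbol) (intro add_mono stiffness_form_le)
  also have "\<dots> = ?B * (\<Sum>i\<le>r. (cmod (?U i))\<^sup>2)"
    by (simp add: cmod_power2 sum.distrib distrib_left)
  also have "(\<Sum>i\<le>r. (cmod (?U i))\<^sup>2) = sqnorm r u + (cmod (u 0))\<^sup>2"
    by (simp add: bloch_extension_def sqnorm_def lessThan_Suc_atMost[symmetric] norm_mult)
  also have "?B * \<dots> \<le> ?B * (2 * sqnorm r u)"
  proof (rule mult_left_mono)
    have "(cmod (u 0))\<^sup>2 \<le> sqnorm r u"
      unfolding sqnorm_def using r by (intro member_le_sum) auto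
    then show "sqnorm r u + (cmod (u 0))\<^sup>2 \<le> 2 * sqnorm r u" by simp
  qed (intro sum_nonneg; simp)
  finally show ?thesis by (simp add: mult_ac)
qed

text \<open>
  The constant vector has minimal energy at \<open>\<theta> = 0\<close>; for other \<open>\<theta>\<close> its extension differs from a
  constant only by the jump \<open>e\<^sup>-\<^sup>i\<^sup>\<theta> - 1\<close> at the last node.
\<close>

lemma symbol_constant_vector:
  "quad_form (symbol r \<xi> \<theta>) (\<lambda>_. 1) = (2 - 2 * cos \<theta>) * local_stiffness r \<xi> $$ (r,r)"
proof -
  let ?U = "bloch_extension r \<theta> (\<lambda>_. 1)"
  have "(\<lambda>i. Re (?U i)) = (\<lambda>i. if i < r then 1 else 1 + (cos \<theta> - 1))"
    "(\<lambda>i. Im (?U i)) = (\<lambda>i. if i < r then 0 else 0 + (- sin \<theta>))"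
    by (auto simp: bloch_extension_def)
  then have "quad_form (symbol r \<xi> \<theta>) (\<lambda>_. 1)
      = ((cos \<theta> - 1)\<^sup>2 + (- sin \<theta>)\<^sup>2) * local_stiffness r \<xi> $$ (r,r)"
    using r by (simp only: quad_form_symbol stiffness_form_const_plus_hat[OF inj] distrib_right)
  also have "(cos \<theta> - 1)\<^sup>2 + (- sin \<theta>)\<^sup>2 = 2 - 2 * cos \<theta>"
    using sin_cos_squared_add[of \<theta>] by (simp add: power2_diff)
  finally show ?thesis .
qed

lemma local_stiffness_corner_nonneg: "local_stiffness r \<xi> $$ (r,r) \<ge> 0"
  using stiffness_form_oscillation[OF inj nodes left, of 0 "\<lambda>i. if i < r then 0 else 0 + 1"]
  by (simp only: stiffness_form_const_plus_hat[OF inj]) simp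

lemma south_east_symbol: "south_east (symbol r \<xi> \<theta>) = south_east (symbol r \<xi> 0)"
proof -
  have "dim_row (symbol r \<xi> \<theta>) = r" "dim_col (symbol r \<xi> \<theta>) = r" for \<theta>
    using symbol_carrier[of r \<xi> \<theta>] by auto
  then show ?thesis
    by (intro eq_matI) (simp_all add: south_east_def symbol_entry)
qed

text \<open>
  A vector with \<open>u\<^sub>0 = 0\<close> has an extension that vanishes at the first node, so the oscillation bound
  controls each of its components and the smallest eigenvalue is at least \<open>1 / r\<close>.
\<close>

lemma eig_south_east_symbol_pos: "eig 1 (south_east (symbol r \<xi> \<theta>)) > 0"
proof -
  note C = symbol_carrier[of r \<xi> \<theta>] and H = symbol_hermitian[of r \<xi> \<theta>]
  obtain y where y: "sqnorm (r - 1) y = 1"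
    "quad_form (south_east (symbol r \<xi> \<theta>)) y = eig 1 (south_east (symbol r \<xi> \<theta>))"
    using eig_attained[OF south_east_hermitian[OF C H], of 1] r by force
  define x where "x = case_nat 0 y"
  have x: "x 0 = 0" "(\<lambda>i. x (Suc i)) = y" by (simp_all add: x_def)
  let ?q = "quad_form (symbol r \<xi> \<theta>) x"
  have q: "?q = eig 1 (south_east (symbol r \<xi> \<theta>))" and s: "sqnorm r x = 1"
    using quad_form_south_east[OF C, of x] x y r by simp_all
  have "(cmod (x i))\<^sup>2 \<le> ?q" if "i < r" for i
    using symbol_oscillation[of i \<theta> x] that r x(1) by (simp add: bloch_extension_def)
  then have "sqnorm r x \<le> (\<Sum>i<r. ?q)"
    unfolding sqnorm_def by (intro sum_mono) auto
  then have "1 \<le> real r * ?q" using s by simp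
  then show ?thesis using q r by (metis not_le not_one_le_zero mult_nonneg_nonpos of_nat_0_le_iff order.trans)
qed

end

theorem theorem4p6:
  fixes r :: nat and \<xi> :: "nat \<Rightarrow> real"
  assumes "r \<ge> 2"
    and "\<xi> ` {1..r+1} \<subseteq> {0..1}"
    and "inj_on \<xi> {1..r+1}"
    and "\<xi> 1 = 0"
    and "\<xi> (r+1) = 1"
  shows
    "(\<exists>C\<^sub>1>0. \<exists>C\<^sub>2>0. \<forall>\<theta>\<in>{-pi..pi}.
        C\<^sub>1 * (2 - 2 * cos \<theta>) \<le> eig 1 (symbol r \<xi> \<theta>) \<and>
        eig 1 (symbol r \<xi> \<theta>) \<le> C\<^sub>2 * (2 - 2 * cos \<theta>))
     \<and> (\<exists>m>0. \<exists>M>0. \<forall>\<theta>\<in>{-pi..pi}. \<forall>j\<in>{2..r}.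
        m \<le> eig j (symbol r \<xi> \<theta>) \<and> eig j (symbol r \<xi> \<theta>) \<le> M)
     \<and> (\<exists>S. (\<forall>\<theta>\<in>{-pi..pi}. south_east (symbol r \<xi> \<theta>) = S)
          \<and> eig 1 S > 0
          \<and> (\<exists>M>0. \<forall>\<theta>\<in>{-pi..pi}. \<forall>j\<in>{2..r}.
               eig 1 S \<le> eig j (symbol r \<xi> \<theta>) \<and> eig j (symbol r \<xi> \<theta>) \<le> M))"
proof -
  note ctxt = assms(1,3,2,4)
  note C = symbol_carrier[of r \<xi>] and H = symbol_hermitian[of r \<xi>]
  let ?w = "\<lambda>\<theta>::real. 2 - 2 * cos \<theta>" and ?f = "symbol r \<xi>"
  define k where "k = local_stiffness r \<xi> $$ (r,r)"
  define S where "S = south_east (?f 0)"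
  \<comment> \<open>The summands 1 here and in \<open>(k + 1) / r\<close> below make the constants strictly positive.\<close>
  define M where "M = 2 * (\<Sum>i\<le>r. \<Sum>j\<le>r. \<bar>local_stiffness r \<xi> $$ (i,j)\<bar>) + 1"
  have k: "k \<ge> 0" unfolding k_def by (rule local_stiffness_corner_nonneg[OF ctxt])
  have r: "real r > 0" using assms(1) by simp
  have w: "?w \<theta> \<ge> 0" for \<theta> using cos_le_one[of \<theta>] by linarith
  have lower: "1 / (10 * r) * ?w \<theta> \<le> eig 1 (?f \<theta>)" for \<theta>
  proof -
    obtain x where "sqnorm r x = 1" "quad_form (?f \<theta>) x = eig 1 (?f \<theta>)"
      using eig_attained[OF C[of \<theta>] H, of 1] assms(1) by auto
    then show ?thesis
      using symbol_coercive[OF ctxt, of \<theta> x] r by (simp add: field_simps)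
  qed
  have upper: "eig 1 (?f \<theta>) \<le> (k + 1) / r * ?w \<theta>" for \<theta>
  proof -
    have "eig 1 (?f \<theta>) * r \<le> k * ?w \<theta>"
      using eig_1_le_rayleigh[OF C[of \<theta>] H, of "\<lambda>_. 1"] symbol_constant_vector[OF ctxt, of \<theta>]
      by (simp add: sqnorm_def k_def mult.commute)
    also have "\<dots> \<le> (k + 1) * ?w \<theta>" using w by (simp add: distrib_right)
    finally show ?thesis using r by (simp add: field_simps)
  qed
  have S: "south_east (?f \<theta>) = S" for \<theta>
    unfolding S_def by (rule south_east_symbol[OF ctxt])
  have pos: "eig 1 S > 0"
    unfolding S_def by (rule eig_south_east_symbol_pos[OF ctxt])
  have M: "M > 0" unfolding M_def by (intro add_nonneg_pos mult_nonneg_nonneg sum_nonneg) auto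
  have others: "eig 1 S \<le> eig j (?f \<theta>) \<and> eig j (?f \<theta>) \<le> M" if j: "j \<in> {2..r}" for \<theta> j
  proof
    have "eig 1 S \<le> eig 2 (?f \<theta>)"
      using south_east_interlacing[OF C H assms(1)] S by metis
    also have "\<dots> \<le> eig j (?f \<theta>)" using j by (intro eig_mono[OF C H]) auto
    finally show "eig 1 S \<le> eig j (?f \<theta>)" .
    obtain x where "sqnorm r x = 1" "quad_form (?f \<theta>) x = eig j (?f \<theta>)"
      using eig_attained[OF C[of \<theta>] H, of j] j by auto
    then show "eig j (?f \<theta>) \<le> M"
      using symbol_bounded[OF ctxt, of \<theta> x] by (simp add: M_def)
  qed
  have "\<exists>C\<^sub>1>0. \<exists>C\<^sub>2>0. \<forall>\<theta>\<in>{-pi..pi}. C\<^sub>1 * ?w \<theta> \<le> eig 1 (?f \<theta>) \<and> eig 1 (?f \<theta>) \<le> C\<^sub>2 * ?w \<theta>"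
    using lower upper r k
    by (intro exI[of _ "1 / (10 * real r)"] exI[of _ "(k + 1) / real r"] conjI ballI) auto
  then show ?thesis using S pos M others by blast
qed

end
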